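(* For any $f\in\mathcal{H}$ and $w\in\mathcal{A}$, one has \[ \widetilde{S(f)}(wx)=(G_f\diamond w)\,x . \]
   Context: $\mathcal{A}=\mathbb{Q}\langle x,y\rangle$ is the noncommutative polynomial algebra over $\mathbb{Q}$ in two indeterminates $x,y$. For $u\in\mathcal{A}$, $L_u,R_u:\mathcal{A}\to\mathcal{A}$ are the $\mathbb{Q}$-linear maps $L_u(w)=uw$, $R_u(w)=wu$; $L_y^{-1}:y\mathcal{A}\to\mathcal{A}$ is the inverse of $L_y:\mathcal{A}\to y\mathcal{A}$. Hopf algebra $\mathcal{H}$. A rooted tree is a finite (nonempty, non-planar) tree with a distinguished root; a forest is a finite commutative product $t_1\cdots t_n$ of rooted trees; $\mathbb{I}$ is the empty forest. $\mathcal{H}$ (Connes–Kreimer Hopf algebra) is the $\mathbb{Q}$-vector space with basis the forests, with commutative multiplication of forests and unit $\mathbb{I}$. The linear map $B_+:\mathcal{H}\to\mathcal{H}$ sends a forest to the rooted tree obtained by grafting all its roots onto a common new root; $B_+(\mathbb{I})=\bullet$ is the one-vertex tree. Every rooted tree is $B_+(f)$ for a unique forest $f$. The coproduct $\Delta$ is the algebra homomorphism ($\Delta(gh)=\Delta(g)\Delta(h)$, $\Delta(\mathbb{I})=\mathbb{I}\otimes\mathbb{I}$) with $\Delta(t)=\mathbb{I}\otimes t+(B_+\otimes\mathrm{id})(\Delta(f))$ for a tree $t=B_+(f)$. Sweedler notation: $\Delta(f)=\sum_{(f)}f'\otimes f''$. $S$ denotes the antipode of $\mathcal{H}$. Rooted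 tree maps. For $f\in\mathcal{H}$ the $\mathbb{Q}$-linear map $\tilde f:\mathcal{A}\to\mathcal{A}$ (linear in $f$) is defined recursively by: (1) $\tilde{\mathbb{I}}=\mathrm{id}$; (2) $\tilde{\bullet}(x)=yx$, $\tilde{\bullet}(y)=-yx$; (3) $\tilde t(u)=L_yL_{x+2y}L_y^{-1}\tilde f(u)$ if $t=B_+(f)$ is a tree with $f\neq\mathbb{I}$; (4) $\tilde f(u)=\tilde g(\tilde h(u))$ if $f=gh$; (5) $\tilde f(uw)=\sum_{(f)}\tilde{f'}(u)\tilde{f''}(w)$; where $w\in\mathcal{A}$, $u\in\{x,y\}$. It is known that this is well defined and that $f\mapsto\tilde f$ is an algebra homomorphism $\mathcal{H}\to\mathrm{End}(\mathcal{A})$. $\widetilde{S(f)}$ is the rooted tree map of $S(f)$. Product $\diamond$. The $\mathbb{Q}$-bilinear, commutative, associative product $\diamond$ on $\mathcal{A}$ is defined by $w\diamond 1=1\diamond w=w$ and $xw_1\diamond xw_2=x(w_1\diamond xw_2)-x(yw_1\diamond w_2)$, $xw_1\diamond yw_2=x(w_1\diamond yw_2)+y(xw_1\diamond w_2)$, $yw_1\diamond xw_2=y(w_1\diamond xw_2)+x(yw_1\diamond w_2)$, $yw_1\diamond yw_2=y(w_1\diamond yw_2)-y(xw_1\diamond w_2)$ for $w,w_1,w_2\in\mathcal{A}$. Polynomials $G_f$. For a forest $f$, $G_f\in\mathbb{Q}+y\mathcal{A}$ is defined recursively by: $G_{\mathbb{I}}=1$; $G_{\bullet}=-y$; $G_t=R_{2x+y}(G_f)=G_f\,(2x+y)$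 if $t=B_+(f)$ is a tree and $f\neq\mathbb{I}$; $G_f=G_g\diamond G_h$ if $f=gh$. It is extended linearly to $f\in\mathcal{H}$. *)

theory Defs
  imports Complex_Main "HOL-Library.Multiset" "HOL-Library.Poly_Mapping" "HOL-Library.Product_Plus"
begin

section \<open>Linear extension from a basis\<close>

text \<open>
  The rational vector space with basis \<open>'k\<close> is \<open>'k \<Rightarrow>\<^sub>0 rat\<close>, the basis vector of \<open>k\<close> being
  \<open>Poly_Mapping.single k 1\<close>.  If \<open>'k\<close> is a monoid, written additively, then multiplication
  on \<open>'k \<Rightarrow>\<^sub>0 rat\<close> is that of the monoid algebra.
\<close>

definition qscale :: "rat \<Rightarrow> ('k \<Rightarrow>\<^sub>0 rat) \<Rightarrow> ('k \<Rightarrow>\<^sub>0 rat)" where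
  "qscale c p = Poly_Mapping.map ((*) c) p"

lemma lookup_qscale [simp]: "Poly_Mapping.lookup (qscale c p) k = c * Poly_Mapping.lookup p k"
  by (simp add: qscale_def Poly_Mapping.map.rep_eq when_def)

lemma vector_space_qscale: "vector_space qscale"
  by unfold_locales (auto intro!: poly_mapping_eqI simp: lookup_add algebra_simps)

abbreviation qlinear :: "(('k \<Rightarrow>\<^sub>0 rat) \<Rightarrow> ('l \<Rightarrow>\<^sub>0 rat)) \<Rightarrow> bool" where
  "qlinear \<equiv> Vector_Spaces.linear qscale qscale"

definition lin_ext :: "('k \<Rightarrow> ('l \<Rightarrow>\<^sub>0 rat)) \<Rightarrow> ('k \<Rightarrow>\<^sub>0 rat) \<Rightarrow> ('l \<Rightarrow>\<^sub>0 rat)" where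
  "lin_ext F p = (\<Sum>k\<in>Poly_Mapping.keys p. qscale (Poly_Mapping.lookup p k) (F k))"


section \<open>The noncommutative polynomial algebra\<close>

instantiation list :: (type) monoid_add
begin

definition zero_list :: "'a list" where "zero_list = []"
definition plus_list :: "'a list \<Rightarrow> 'a list \<Rightarrow> 'a list" where "plus_list = (@)"

instance
  by standard (simp_all add: zero_list_def plus_list_def)

end

datatype letter = X | Y

type_synonym ncpoly = "letter list \<Rightarrow>\<^sub>0 rat"

definition word :: "letter list \<Rightarrow> ncpoly" where
  "word w = Poly_Mapping.single w 1"

definition xA :: ncpoly where "xA = word [X]"
definition yA :: ncpoly where "yA = word [Y]"

text \<open>The product \<open>\<diamondop>\<close> on words, and its bilinear extension.\<close>

fun diamond_words :: "letter list \<Rightarrow> letter list \<Rightarrow> ncpoly" where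
  "diamond_words [] w = word w"
| "diamond_words (a # w) [] = word (a # w)"
| "diamond_words (X # v) (X # w) = xA * diamond_words v (X # w) - xA * diamond_words (Y # v) w"
| "diamond_words (X # v) (Y # w) = xA * diamond_words v (Y # w) + yA * diamond_words (X # v) w"
| "diamond_words (Y # v) (X # w) = yA * diamond_words v (X # w) + xA * diamond_words (Y # v) w"
| "diamond_words (Y # v) (Y # w) = yA * diamond_words v (Y # w) - yA * diamond_words (X # v) w"

definition diamond :: "ncpoly \<Rightarrow> ncpoly \<Rightarrow> ncpoly" (infixl \<open>\<diamondop>\<close> 70) where
  "p \<diamondop> q = lin_ext (\<lambda>v. lin_ext (\<lambda>w. diamond_words v w) q) p"


section \<open>The Connes--Kreimer Hopf algebra\<close>

text \<open>
  \<open>Node f\<close> is the tree obtained by grafting the roots of the forest \<open>f\<close> onto a new root,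
  i.e. \<open>B\<^sub>+ f\<close>.  Forests form a commutative monoid under multiset union, so \<open>hopf\<close> is a
  commutative ring.  The tensor square of \<open>hopf\<close> is the space with basis the pairs of
  forests; its multiplication is that of the monoid algebra of the product monoid, i.e.
  \<open>(a \<otimes> b) * (c \<otimes> d) = (a * c) \<otimes> (b * d)\<close>.
\<close>

datatype tree = Node "tree multiset"

type_synonym forest = "tree multiset"
type_synonym hopf = "forest \<Rightarrow>\<^sub>0 rat"
type_synonym hopf2 = "(forest \<times> forest) \<Rightarrow>\<^sub>0 rat"

primrec coproduct_tree :: "tree \<Rightarrow> hopf2" where
  "coproduct_tree (Node f) =
     Poly_Mapping.single ({#}, {#Node f#}) 1
     + lin_ext (\<lambda>(a, b). Poly_Mapping.single ({#Node a#}, b) 1)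
         (prod_mset (image_mset coproduct_tree f))"

definition coproduct_forest :: "forest \<Rightarrow> hopf2" where
  "coproduct_forest f = prod_mset (image_mset coproduct_tree f)"

definition coproduct :: "hopf \<Rightarrow> hopf2" where
  "coproduct = lin_ext coproduct_forest"

definition counit :: "hopf \<Rightarrow> rat" where
  "counit h = Poly_Mapping.lookup h {#}"

definition is_antipode :: "(hopf \<Rightarrow> hopf) \<Rightarrow> bool" where
  "is_antipode S \<longleftrightarrow> qlinear S \<and>
     (\<forall>h. lin_ext (\<lambda>(a, b). S (Poly_Mapping.single a 1) * Poly_Mapping.single b 1) (coproduct h)
            = qscale (counit h) 1) \<and>
     (\<forall>h. lin_ext (\<lambda>(a, b). Poly_Mapping.single a 1 * S (Poly_Mapping.single b 1)) (coproduct h)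
            = qscale (counit h) 1)"

definition antipode :: "hopf \<Rightarrow> hopf" where
  "antipode = (THE S. is_antipode S)"


section \<open>Rooted tree maps\<close>

text \<open>
  The recursion defining the rooted tree maps of forests.  In the clause for \<open>Node f\<close>,
  \<open>inv ((*) yA)\<close> is meant as the inverse of left multiplication by \<open>y\<close> as a map onto
  \<open>y\<A>\<close>; that \<open>F f u\<close> lies in \<open>y\<A>\<close> is therefore part of the clause.
\<close>

definition is_rooted_tree_maps :: "(forest \<Rightarrow> ncpoly \<Rightarrow> ncpoly) \<Rightarrow> bool" where
  "is_rooted_tree_maps F \<longleftrightarrow>
     (\<forall>f. qlinear (F f)) \<and>
     F {#} = id \<and>
     F {#Node {#}#} xA = yA * xA \<and>
     F {#Node {#}#} yA = - (yA * xA) \<and>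
     (\<forall>f. \<forall>u\<in>{xA, yA}. f \<noteq> {#} \<longrightarrow>
        (\<exists>v. F f u = yA * v) \<and>
        F {#Node f#} u = yA * ((xA + 2 * yA) * inv ((*) yA) (F f u))) \<and>
     (\<forall>g h. \<forall>u\<in>{xA, yA}. F (g + h) u = F g (F h u)) \<and>
     (\<forall>f w. \<forall>u\<in>{xA, yA}. F f (u * w) = lin_ext (\<lambda>(a, b). F a u * F b w) (coproduct_forest f))"

definition rooted_tree_map_forest :: "forest \<Rightarrow> ncpoly \<Rightarrow> ncpoly" where
  "rooted_tree_map_forest = (THE F. is_rooted_tree_maps F)"

definition rooted_tree_map :: "hopf \<Rightarrow> ncpoly \<Rightarrow> ncpoly" where
  "rooted_tree_map h w = lin_ext (\<lambda>f. rooted_tree_map_forest f w) h"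


section \<open>The polynomials attached to forests\<close>

text \<open>
  The fold multiplies the polynomials of the trees of a forest with respect to \<open>\<diamondop>\<close>; since
  \<open>\<diamondop>\<close> is commutative and associative, the order of the factors is irrelevant.
\<close>

primrec G_tree :: "tree \<Rightarrow> ncpoly" where
  "G_tree (Node f) =
     (if f = {#} then - yA else fold_mset (\<diamondop>) 1 (image_mset G_tree f) * (2 * xA + yA))"

definition G_forest :: "forest \<Rightarrow> ncpoly" where
  "G_forest f = fold_mset (\<diamondop>) 1 (image_mset G_tree f)"

definition G :: "hopf \<Rightarrow> ncpoly" where
  "G = lin_ext G_forest"

end

theory Submission
  imports Defs
begin

text \<open>
  Put \<open>z = x + y\<close>.  The product \<open>\<diamondop>\<close> is bilinear over the polynomials in \<open>z\<close>, acting by left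
  multiplication, and left multiplication by \<open>x\<close> is a Rota--Baxter operator of weight \<open>-z\<close>
  for it.  Let \<open>H\<close> be the \<open>\<diamondop>\<close>-multiplicative map on forests that satisfies the recursion (3)
  of the rooted tree maps.  The maps given by \<open>w x \<mapsto> (H\<^sub>f \<diamondop> w) x\<close> and compatible
  with right multiplication by \<open>z\<close> are multiplicative in \<open>f\<close> because \<open>\<diamondop>\<close> is associative, and
  they satisfy the Leibniz rule (5) because the inverse of \<open>H\<close> for the convolution given by
  concatenation is explicit: up to sign it is \<open>y z\<^bsup>n-1\<^esup>\<close> on a forest with \<open>n > 0\<close> vertices.
  Hence they are the rooted tree maps.  The same inverse shows that \<open>G\<close> is the inverse of \<open>H\<close>
  for the convolution given by \<open>\<diamondop>\<close>, so that \<open>G\<close> is \<open>H\<close> composed with the antipode.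
\<close>

section \<open>Linear extension\<close>

lemma qscale_1 [simp]: "qscale 1 p = p"
  and qscale_0 [simp]: "qscale 0 p = 0"
  and qscale_zero [simp]: "qscale c 0 = 0"
  and qscale_add: "qscale c (p + q) = qscale c p + qscale c q"
  and qscale_diff: "qscale c (p - q) = qscale c p - qscale c q"
  and qscale_left_add: "qscale (c + d) p = qscale c p + qscale d p"
  and qscale_left_minus: "qscale (- c) p = - qscale c p"
  and qscale_qscale [simp]: "qscale c (qscale d p) = qscale (c * d) p"
  and qscale_single [simp]: "qscale c (Poly_Mapping.single k d) = Poly_Mapping.single k (c * d)"
  by (auto intro!: poly_mapping_eqI simp: lookup_add lookup_minus algebra_simps lookup_single when_def)

text \<open>Constants sit at the neutral basis element and commute with every basis vector, so
  scaling inside products reduces to associativity.\<close>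

lemma qscale_conv_mult: "qscale c p = Poly_Mapping.single 0 c * p"
proof (rule poly_mapping_eqI)
  fix k
  have "Poly_Mapping.lookup (Poly_Mapping.single 0 c * p) k
      = Sum_any (\<lambda>l. Poly_Mapping.lookup (Poly_Mapping.single 0 c) l *
           Sum_any (\<lambda>q. Poly_Mapping.lookup p q when k = l + q))"
    by (simp add: lookup_mult)
  also have "\<dots> = Sum_any (\<lambda>l. c * Sum_any (\<lambda>q. Poly_Mapping.lookup p q when k = q) when l = 0)"
    by (simp add: lookup_single when_def if_distrib if_distribR cong: if_cong)
  finally show "Poly_Mapping.lookup (qscale c p) k
      = Poly_Mapping.lookup (Poly_Mapping.single 0 c * p) k"
    by simp
qed

lemma qscale_mult_left: "qscale c p * q = qscale c (p * q)"
  by (simp add: qscale_conv_mult mult.assoc)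

lemma sum_keys_qscale:
  "(\<Sum>k\<in>Poly_Mapping.keys p. qscale (Poly_Mapping.lookup p k) (Poly_Mapping.single k 1)) = p"
  by (rule poly_mapping_eqI)
    (simp add: lookup_sum lookup_single when_def not_in_keys_iff_lookup_eq_zero if_distrib cong: if_cong)

lemma basis_induct [case_names single add scale]:
  assumes "\<And>k. P (Poly_Mapping.single k (1::rat))"
    and add: "\<And>p q. P p \<Longrightarrow> P q \<Longrightarrow> P (p + q)"
    and scale: "\<And>c p. P p \<Longrightarrow> P (qscale c p)"
  shows "P p"
proof -
  \<comment> \<open>Zero is 0 times a basis vector, \<open>undefined\<close> standing for an
    arbitrary basis element.\<close>
  have "P 0"
    using scale[OF assms(1)[of undefined], of 0] by simp
  have "P (\<Sum>k\<in>A. qscale (Poly_Mapping.lookup p k) (Poly_Mapping.single k 1))" if "finite A" for A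
    using that by (induction rule: finite_induct) (auto simp del: qscale_single intro!: assms \<open>P 0\<close>)
  from this[OF finite_keys, of p] show ?thesis
    unfolding sum_keys_qscale .
qed

lemma qlinear_iff:
  "qlinear T \<longleftrightarrow> (\<forall>p q. T (p + q) = T p + T q) \<and> (\<forall>c p. T (qscale c p) = qscale c (T p))"
  unfolding Vector_Spaces.linear_def module_hom_def module_hom_axioms_def
  by (auto simp: vector_space_qscale module_iff_vector_space)

lemma qlinearI:
  "(\<And>p q. T (p + q) = T p + T q) \<Longrightarrow> (\<And>c p. T (qscale c p) = qscale c (T p)) \<Longrightarrow> qlinear T"
  by (simp add: qlinear_iff)

lemma qlinear_add: "qlinear T \<Longrightarrow> T (p + q) = T p + T q"
  and qlinear_scale: "qlinear T \<Longrightarrow> T (qscale c p) = qscale c (T p)"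
  by (simp_all add: qlinear_iff)

lemma qlinear_0: "qlinear T \<Longrightarrow> T 0 = 0"
  using qlinear_scale[of T 0 0] by simp

lemma qlinear_minus: "qlinear T \<Longrightarrow> T (- p) = - T p"
  using qlinear_scale[of T "-1" p] by (simp add: qscale_left_minus)

lemma qlinear_diff: "qlinear T \<Longrightarrow> T (p - q) = T p - T q"
  using qlinear_add[of T p "- q"] by (simp add: qlinear_minus)

lemma qlinear_eqI:
  assumes "qlinear T" "qlinear U" "\<And>k. T (Poly_Mapping.single k 1) = U (Poly_Mapping.single k 1)"
  shows "T p = U p"
  by (induction p rule: basis_induct) (simp_all add: assms qlinear_add qlinear_scale)

text \<open>Supports can shrink under addition and scaling; linearity is therefore checked over a
  common finite superset.\<close>

lemma lin_ext_superset:
  assumes "finite A" "Poly_Mapping.keys p \<subseteq> A"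
  shows "lin_ext F p = (\<Sum>k\<in>A. qscale (Poly_Mapping.lookup p k) (F k))"
  unfolding lin_ext_def using assms
  by (intro sum.mono_neutral_left) (auto simp: not_in_keys_iff_lookup_eq_zero)

lemma lin_ext_add: "lin_ext F (p + q) = lin_ext F p + lin_ext F q"
proof -
  let ?A = "Poly_Mapping.keys p \<union> Poly_Mapping.keys q"
  have "Poly_Mapping.keys (p + q) \<subseteq> ?A"
    by (rule keys_add)
  then show ?thesis
    by (simp add: lin_ext_superset[where A = ?A] lookup_add qscale_left_add sum.distrib)
qed

lemma lin_ext_scale: "lin_ext F (qscale c p) = qscale c (lin_ext F p)"
proof -
  have "Poly_Mapping.keys (qscale c p) \<subseteq> Poly_Mapping.keys p"
    by (auto simp: in_keys_iff)
  moreover have "qscale c (\<Sum>k\<in>A. qscale (h k) (F k)) = (\<Sum>k\<in>A. qscale (c * h k) (F k))" for A h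
    by (induction A rule: infinite_finite_induct) (simp_all add: qscale_add)
  ultimately show ?thesis
    by (simp add: lin_ext_superset[where A = "Poly_Mapping.keys p"])
qed

lemma qlinear_lin_ext: "qlinear (lin_ext F)"
  by (rule qlinearI) (rule lin_ext_add lin_ext_scale)+

lemmas lin_ext_0 [simp] = qlinear_0[OF qlinear_lin_ext]

lemma lin_ext_single [simp]: "lin_ext F (Poly_Mapping.single k 1) = F k"
  by (simp add: lin_ext_def)

lemma qlinear_lin_ext_fun: "(\<And>k. qlinear (F k)) \<Longrightarrow> qlinear (\<lambda>q. lin_ext (\<lambda>k. F k q) p)"
  by (induction p rule: basis_induct)
    (auto simp: qlinear_iff lin_ext_add lin_ext_scale qscale_add mult.commute)

lemma qlinear_comp: "qlinear T \<Longrightarrow> qlinear U \<Longrightarrow> qlinear (\<lambda>p. T (U p))"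
  by (simp add: qlinear_iff)

lemma lin_ext_image: "qlinear T \<Longrightarrow> T (lin_ext F p) = lin_ext (\<lambda>k. T (F k)) p"
  by (induction p rule: basis_induct) (simp_all add: lin_ext_add lin_ext_scale qlinear_add qlinear_scale)

lemma lin_ext_fun_add:
  fixes F G :: "'k \<Rightarrow> 'l \<Rightarrow>\<^sub>0 rat"
  shows "lin_ext (\<lambda>k. F k + G k) p = lin_ext F p + lin_ext G p"
  by (induction p rule: basis_induct) (simp_all add: lin_ext_add lin_ext_scale qscale_add)

lemma lin_ext_fun_0: "lin_ext (\<lambda>k. 0) p = 0"
  by (simp add: lin_ext_def)

lemma lin_ext_swap:
  "lin_ext (\<lambda>a. lin_ext (\<lambda>b. F a b) q) p = lin_ext (\<lambda>b. lin_ext (\<lambda>a. F a b) p) q"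
proof (induction p rule: basis_induct)
  case (scale c p)
  have "lin_ext (\<lambda>b. lin_ext (\<lambda>a. F a b) (qscale c p)) q
      = qscale c (lin_ext (\<lambda>b. lin_ext (\<lambda>a. F a b) p) q)"
    by (subst lin_ext_image) (simp_all add: lin_ext_scale qlinear_iff qscale_add mult.commute)
  with scale show ?case
    by (simp add: lin_ext_scale)
next
  case (add p p')
  then show ?case
    by (simp add: lin_ext_add lin_ext_fun_add)
qed simp

lemma qlinear_mult_left: "qlinear (\<lambda>p. p * (q :: 'a::monoid_add \<Rightarrow>\<^sub>0 rat))"
  by (rule qlinearI) (simp_all add: ring_distribs qscale_mult_left)

lemma qlinear_mult_right: "qlinear ((*) (p :: 'a::monoid_add \<Rightarrow>\<^sub>0 rat))"
proof (rule qlinearI)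
  fix c and q :: "'a \<Rightarrow>\<^sub>0 rat"
  have "qlinear (\<lambda>p :: 'a \<Rightarrow>\<^sub>0 rat. p * qscale c q)" "qlinear (\<lambda>p :: 'a \<Rightarrow>\<^sub>0 rat. qscale c (p * q))"
    by (simp_all add: qlinear_iff ring_distribs qscale_mult_left qscale_add mult.commute)
  then show "p * qscale c q = qscale c (p * q)"
  proof (rule qlinear_eqI)
    fix k
    show "Poly_Mapping.single k 1 * qscale c q = qscale c (Poly_Mapping.single k 1 * q)"
      by (simp add: qscale_conv_mult mult.assoc[symmetric] mult_single)
  qed
qed (simp add: ring_distribs)

lemma qscale_mult_right: "(p :: 'a::monoid_add \<Rightarrow>\<^sub>0 rat) * qscale c q = qscale c (p * q)"
  by (rule qlinear_scale[OF qlinear_mult_right])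

lemma lin_ext_mult:
  fixes p q :: "'a::monoid_add \<Rightarrow>\<^sub>0 rat"
  shows "lin_ext F (p * q) = lin_ext (\<lambda>a. lin_ext (\<lambda>b. F (a + b)) q) p"
proof (induction p rule: basis_induct)
  case (single k)
  show ?case
    by (induction q rule: basis_induct)
      (simp_all add: lin_ext_add lin_ext_scale mult_single ring_distribs qscale_mult_right
        del: qscale_single)
qed (simp_all add: lin_ext_add lin_ext_scale ring_distribs qscale_mult_left)

section \<open>The diamond product\<close>

abbreviation zA :: ncpoly where "zA \<equiv> xA + yA"

lemma word_Nil: "word [] = 1"
  by (simp add: word_def zero_list_def[symmetric])

lemma word_mult: "word v * word w = word (v @ w)"
  by (simp add: word_def mult_single plus_list_def)

lemma word_Cons: "word (a # w) = (if a = X then xA else yA) * word w"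
  by (cases a) (simp_all add: xA_def yA_def word_mult)

lemma ncpoly_induct [case_names word add scale]:
  assumes "\<And>w. P (word w)" "\<And>p q. P p \<Longrightarrow> P q \<Longrightarrow> P (p + q)" "\<And>c p. P p \<Longrightarrow> P (qscale c p)"
  shows "P p"
  using assms by (induction p rule: basis_induct) (auto simp: word_def)

lemma ncpoly_eqI:
  assumes "qlinear T" "qlinear U" "\<And>w. T (word w) = U (word w)"
  shows "T p = U p"
  by (rule qlinear_eqI) (use assms in \<open>auto simp: word_def\<close>)

lemma ncpoly_diff:
  assumes "\<And>p q. P p \<Longrightarrow> P q \<Longrightarrow> P (p + q)" "\<And>c p. P p \<Longrightarrow> P (qscale c (p :: ncpoly))" "P p" "P q"
  shows "P (p - q)"
  using assms(1)[OF assms(3) assms(2)[OF assms(4), of "-1"]] by (simp add: qscale_left_minus)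

text \<open>The elements x and z = x + y also generate, since y = z - x; in them the rules for the
  diamond product are simplest.\<close>

lemma ncpoly_induct_left [case_names 1 x z add scale]:
  assumes 1: "P 1" and x: "\<And>p. P p \<Longrightarrow> P (xA * p)" and z: "\<And>p. P p \<Longrightarrow> P (zA * p)"
    and add: "\<And>p q. P p \<Longrightarrow> P q \<Longrightarrow> P (p + q)" and scale: "\<And>c p. P p \<Longrightarrow> P (qscale c p)"
  shows "P (p :: ncpoly)"
proof (induction p rule: ncpoly_induct)
  case (word w)
  show ?case
  proof (induction w)
    case (Cons a w)
    have "P (yA * word w)"
      using ncpoly_diff[of P, OF add scale z[OF Cons] x[OF Cons]] by (simp add: algebra_simps)
    with x[OF Cons] show ?case
      by (simp add: word_Cons)
  qed (simp add: word_Nil 1)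
qed (auto intro: add scale)

lemma ncpoly_induct_right [case_names 1 x z add scale]:
  assumes 1: "P 1" and x: "\<And>p. P p \<Longrightarrow> P (p * xA)" and z: "\<And>p. P p \<Longrightarrow> P (p * zA)"
    and add: "\<And>p q. P p \<Longrightarrow> P q \<Longrightarrow> P (p + q)" and scale: "\<And>c p. P p \<Longrightarrow> P (qscale c p)"
  shows "P (p :: ncpoly)"
proof (induction p rule: ncpoly_induct)
  case (word w)
  show ?case
  proof (induction w rule: rev_induct)
    case (snoc a w)
    have "P (word w * yA)"
      using ncpoly_diff[of P, OF add scale z[OF snoc] x[OF snoc]] by (simp add: algebra_simps)
    with x[OF snoc] show ?case
      by (cases a) (simp_all add: xA_def yA_def word_mult)
  qed (simp add: word_Nil 1)
qed (auto intro: add scale)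

text \<open>Removing the first \<open>length v\<close> letters of every word is a linear left
  inverse.\<close>

lemma word_left_cancel:
  assumes "word v * p = word v * q"
  shows "p = q"
proof -
  have "lin_ext (\<lambda>w. word (drop (length v) w)) (word v * r) = r" for r
    unfolding word_def lin_ext_mult lin_ext_single plus_list_def
    by (rule qlinear_eqI) (simp_all add: qlinear_iff lin_ext_add lin_ext_scale)
  with assms show ?thesis
    by metis
qed

lemma xA_cancel: "xA * p = xA * q \<Longrightarrow> p = q"
  and yA_cancel: "yA * p = yA * q \<Longrightarrow> p = q"
  by (auto simp: xA_def yA_def dest: word_left_cancel)

lemma inv_yA [simp]: "inv ((*) yA) (yA * p) = p"
  by (rule inv_f_f) (auto intro: injI yA_cancel)

text \<open>The linear map that deletes a leading y and kills all other words sends xr to 0 and yr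
  to r, so it is a left inverse.\<close>

lemma zA_cancel:
  assumes "zA * p = zA * q"
  shows "p = q"
proof -
  have *: "lin_ext (\<lambda>w. if w = [] \<or> hd w = X then 0 else word (tl w)) (zA * r) = r" for r
    unfolding word_def xA_def yA_def distrib_right lin_ext_add lin_ext_mult lin_ext_single plus_list_def
    by (rule qlinear_eqI) (simp_all add: qlinear_lin_ext qlinear_iff lin_ext_fun_0 lin_ext_add lin_ext_scale)
  show ?thesis
    using assms *[of p] *[of q] by metis
qed

section \<open>Bilinearity over the polynomials in z, commutativity and associativity\<close>

lemma diamond_word: "word v \<diamondop> word w = diamond_words v w"
  by (simp add: diamond_def word_def)

lemma qlinear_diamond_left: "qlinear (\<lambda>p. p \<diamondop> q)"
  unfolding diamond_def by (rule qlinear_lin_ext)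

lemma qlinear_diamond_right: "qlinear (\<lambda>q. p \<diamondop> q)"
  unfolding diamond_def by (rule qlinear_lin_ext_fun) (rule qlinear_lin_ext)

lemmas diamond_linear =
  qlinear_add[OF qlinear_diamond_left] qlinear_add[OF qlinear_diamond_right]
  qlinear_diff[OF qlinear_diamond_left] qlinear_diff[OF qlinear_diamond_right]
  qlinear_minus[OF qlinear_diamond_left] qlinear_minus[OF qlinear_diamond_right]
  qlinear_scale[OF qlinear_diamond_left] qlinear_scale[OF qlinear_diamond_right]

lemma qlinear_add_fun: "qlinear T \<Longrightarrow> qlinear U \<Longrightarrow> qlinear (\<lambda>p. T p + U p)"
  and qlinear_diff_fun: "qlinear T \<Longrightarrow> qlinear U \<Longrightarrow> qlinear (\<lambda>p. T p - U p)"
  by (simp_all add: qlinear_iff qscale_add qscale_diff)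

lemmas ncpoly_linears = qlinear_add_fun qlinear_diff_fun
  qlinear_comp[OF qlinear_mult_left] qlinear_comp[OF qlinear_mult_right]
  qlinear_comp[OF qlinear_diamond_left] qlinear_comp[OF qlinear_diamond_right]

lemma qlinear_id: "qlinear (\<lambda>p. p)"
  by (rule qlinearI) simp_all

lemma one_diamond [simp]: "1 \<diamondop> q = q"
  by (rule ncpoly_eqI[of _ "\<lambda>q. q"])
    (simp_all add: qlinear_id qlinear_diamond_right word_Nil[symmetric] diamond_word)

lemma diamond_one [simp]: "p \<diamondop> 1 = p"
proof (rule ncpoly_eqI[of _ "\<lambda>q. q"])
  fix w
  show "word w \<diamondop> 1 = word w"
    by (cases w) (simp_all add: word_Nil[symmetric] diamond_word)
qed (simp_all add: qlinear_id qlinear_diamond_left)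

lemma bilinear_eqI:
  assumes "\<And>q. qlinear (\<lambda>p. T p q)" "\<And>q. qlinear (\<lambda>p. U p q)"
    and "\<And>p. qlinear (T p)" "\<And>p. qlinear (U p)"
    and "\<And>v w. T (word v) (word w) = U (word v) (word w)"
  shows "T p q = U p q"
  by (rule ncpoly_eqI[of "\<lambda>p. T p q", OF assms(1,2)], rule ncpoly_eqI[OF assms(3,4)], rule assms(5))

lemma diamond_xx: "xA * p \<diamondop> (xA * q) = xA * (p \<diamondop> (xA * q)) - xA * (yA * p \<diamondop> q)"
  by (rule bilinear_eqI, (intro ncpoly_linears qlinear_id)+)
    (simp add: xA_def yA_def word_mult diamond_word)

lemma diamond_xy: "xA * p \<diamondop> (yA * q) = xA * (p \<diamondop> (yA * q)) + yA * (xA * p \<diamondop> q)"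
  by (rule bilinear_eqI, (intro ncpoly_linears qlinear_id)+)
    (simp add: xA_def yA_def word_mult diamond_word)

lemma diamond_yx: "yA * p \<diamondop> (xA * q) = yA * (p \<diamondop> (xA * q)) + xA * (yA * p \<diamondop> q)"
  by (rule bilinear_eqI, (intro ncpoly_linears qlinear_id)+)
    (simp add: xA_def yA_def word_mult diamond_word)

lemma diamond_yy: "yA * p \<diamondop> (yA * q) = yA * (p \<diamondop> (yA * q)) - yA * (xA * p \<diamondop> q)"
  by (rule bilinear_eqI, (intro ncpoly_linears qlinear_id)+)
    (simp add: xA_def yA_def word_mult diamond_word)

text \<open>Add the rules for first factors beginning with x and with y: the terms in which the
  second factor is shortened cancel.\<close>

lemma zA_diamond: "zA * p \<diamondop> q = zA * (p \<diamondop> q)"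
proof (induction q rule: ncpoly_induct)
  case (word w)
  show ?case
  proof (cases w)
    case (Cons a v)
    then show ?thesis
      by (simp add: word_Cons diamond_linear diamond_xx diamond_xy diamond_yx diamond_yy algebra_simps)
  qed (simp add: word_Nil)
qed (simp_all add: diamond_linear distrib_left qscale_mult_right)

text \<open>The proof of commutativity relies on this, so it has its own induction on the first
  factor.\<close>

lemma diamond_zA: "p \<diamondop> (zA * q) = zA * (p \<diamondop> q)"
proof (induction p rule: ncpoly_induct)
  case (word w)
  show ?case
  proof (induction w)
    case (Cons a w)
    \<comment> \<open>Both sums equal \<open>zA * (word w \<diamondop> q)\<close>, by the induction
      hypothesis and \<open>zA_diamond\<close>.\<close>
    have "word w \<diamondop> (xA * q) + word w \<diamondop> (yA * q) = xA * word w \<diamondop> q + yA * word w \<diamondop> q"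
      using Cons zA_diamond[of "word w" q] by (simp add: distrib_right diamond_linear)
    then have *: "word w \<diamondop> (yA * q) = xA * word w \<diamondop> q + yA * word w \<diamondop> q - word w \<diamondop> (xA * q)"
      by (simp add: eq_diff_eq add.commute)
    show ?case
      by (cases a) (simp_all add: word_Cons diamond_linear diamond_xx diamond_xy diamond_yx diamond_yy *
        ring_distribs)
  qed (simp add: word_Nil)
qed (simp_all add: diamond_linear distrib_left qscale_mult_right)

text \<open>The Rota-Baxter identity of weight -z. Its right side is symmetric up to commuting
  products with a shorter factor, unlike the defining rule.\<close>

lemma diamond_xx': "xA * p \<diamondop> (xA * q)
    = xA * (p \<diamondop> (xA * q) + xA * p \<diamondop> q - zA * (p \<diamondop> q))"
proof -
  have *: "yA * p \<diamondop> q = zA * (p \<diamondop> q) - xA * p \<diamondop> q"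
    using zA_diamond[of p q] by (simp add: distrib_right diamond_linear eq_diff_eq add.commute)
  show ?thesis
    unfolding diamond_xx * by (simp add: algebra_simps)
qed

lemma diamond_commute: "p \<diamondop> q = q \<diamondop> p"
proof (induction p arbitrary: q rule: ncpoly_induct_left)
  case (x p)
  show ?case
  proof (induction q rule: ncpoly_induct_left)
    case (x q)
    then show ?case
      by (simp only: diamond_xx' x.IH[symmetric] \<open>\<And>q. p \<diamondop> q = q \<diamondop> p\<close>) (simp add: algebra_simps)
  qed (simp_all only: diamond_linear zA_diamond diamond_zA one_diamond diamond_one)
qed (simp_all only: diamond_linear zA_diamond diamond_zA one_diamond diamond_one)

text \<open>By z-linearity only three factors beginning with x matter. There the Rota-Baxter
  identity expands both sides into the same terms, up to reassociating products in which some factor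
  is shorter.\<close>

lemma diamond_assoc: "p \<diamondop> q \<diamondop> r = p \<diamondop> (q \<diamondop> r)"
proof (induction p arbitrary: q r rule: ncpoly_induct_left)
  case (x p)
  note p = x.IH
  show ?case
  proof (induction q arbitrary: r rule: ncpoly_induct_left)
    case (x q)
    note q = x.IH
    show ?case
    proof (induction r rule: ncpoly_induct_left)
      case (x r)
      note r = x.IH
      have "xA * p \<diamondop> (xA * q) \<diamondop> (xA * r) = xA * (
          (p \<diamondop> (xA * q) + xA * p \<diamondop> q - zA * (p \<diamondop> q)) \<diamondop> (xA * r)
          + xA * p \<diamondop> (xA * q) \<diamondop> r
          - zA * ((p \<diamondop> (xA * q) + xA * p \<diamondop> q - zA * (p \<diamondop> q)) \<diamondop> r))"
        unfolding diamond_xx'[of p q] by (rule diamond_xx')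
      also have "\<dots> = xA * (
          p \<diamondop> (xA * q \<diamondop> (xA * r)) + xA * p \<diamondop> (q \<diamondop> (xA * r) + xA * q \<diamondop> r - zA * (q \<diamondop> r))
          - zA * (p \<diamondop> (q \<diamondop> (xA * r) + xA * q \<diamondop> r - zA * (q \<diamondop> r))))"
        by (simp only: diamond_linear p q r zA_diamond diamond_zA) (simp add: right_diff_distrib distrib_left)
      also have "\<dots> = xA * p \<diamondop> (xA * q \<diamondop> (xA * r))"
        unfolding diamond_xx'[of q r] by (rule diamond_xx'[symmetric])
      finally show ?case .
    qed (simp_all only: diamond_linear zA_diamond diamond_zA one_diamond diamond_one)
  qed (simp_all only: diamond_linear zA_diamond diamond_zA one_diamond diamond_one)
qed (simp_all only: diamond_linear zA_diamond diamond_zA one_diamond diamond_one)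

lemma fold_diamond_add:
  "fold_mset (\<diamondop>) 1 (M + N) = fold_mset (\<diamondop>) 1 M \<diamondop> fold_mset (\<diamondop>) 1 N"
  and fold_diamond_single [simp]: "fold_mset (\<diamondop>) 1 {#p#} = p"
proof -
  interpret comm_monoid_mset "(\<diamondop>)" 1
    by unfold_locales (rule diamond_assoc diamond_commute diamond_one)+
  show "fold_mset (\<diamondop>) 1 (M + N) = fold_mset (\<diamondop>) 1 M \<diamondop> fold_mset (\<diamondop>) 1 N"
    using union[of M N] by (simp only: eq_fold)
  show "fold_mset (\<diamondop>) 1 {#p#} = p"
    using singleton[of p] by (simp only: eq_fold)
qed

section \<open>The coproduct of forests\<close>

text \<open>Combines induction on trees and on multisets, in the shape of the recursions over B_+
  and products.\<close>

lemma forest_induct [case_names empty Node plus]: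
  assumes empty: "P {#}" and Node: "\<And>f. P f \<Longrightarrow> P {#Node f#}"
    and plus: "\<And>f g. P f \<Longrightarrow> P g \<Longrightarrow> P (f + g)"
  shows "P f"
proof -
  have *: "P f" if "\<And>t. t \<in># f \<Longrightarrow> P {#t#}" for f
    using that
  proof (induction f)
    case (add t f)
    then show ?case
      using plus[of "{#t#}" f] by simp
  qed (rule empty)
  have "P {#t#}" for t
    by (induction t) (auto intro: Node *)
  with * show ?thesis
    by blast
qed

section \<open>The grading by the number of vertices\<close>

primrec degree_tree :: "tree \<Rightarrow> nat" where
  "degree_tree (Node f) = Suc (sum_mset (image_mset degree_tree f))"

definition degree_forest :: "forest \<Rightarrow> nat" where
  "degree_forest f = sum_mset (image_mset degree_tree f)"

lemma degree_forest_simps [simp]: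
  "degree_forest {#} = 0"
  "degree_forest {#Node f#} = Suc (degree_forest f)"
  "degree_forest (f + g) = degree_forest f + degree_forest g"
  by (simp_all add: degree_forest_def)

lemma degree_forest_eq_0 [simp]: "degree_forest f = 0 \<longleftrightarrow> f = {#}"
  by (induction f rule: forest_induct) auto

text \<open>For inductions on the degree, whose hypothesis must also cover the Sweedler components
  of \<open>f\<close>.\<close>

lemma forest_cases [case_names empty Node plus]:
  obtains "f = {#}"
  | g where "f = {#Node g#}" "degree_forest g < degree_forest f"
  | g h where "f = g + h" "degree_forest g < degree_forest f" "degree_forest h < degree_forest f"
proof (cases f)
  case (add t g)
  obtain h where t: "t = Node h"
    by (cases t)
  show ?thesis
  proof (cases "g = {#}")
    case True
    with that(2)[of h] show ?thesis
      by (simp add: add t)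
  next
    case False
    then have "degree_forest g \<noteq> 0"
      by simp
    moreover have f: "f = {#Node h#} + g"
      by (simp add: add t)
    ultimately show ?thesis
      by (intro that(3)[OF f]) (simp_all only: f degree_forest_simps)
  qed
qed (rule that(1))

text \<open>In Sweedler notation, \<open>sweedler \<beta> f\<close> is the sum of the \<open>\<beta> f' f''\<close>.\<close>

definition sweedler :: "(forest \<Rightarrow> forest \<Rightarrow> ('l \<Rightarrow>\<^sub>0 rat)) \<Rightarrow> forest \<Rightarrow> ('l \<Rightarrow>\<^sub>0 rat)" where
  "sweedler \<beta> f = lin_ext (\<lambda>(a, b). \<beta> a b) (coproduct_forest f)"

section \<open>Calculus of Sweedler sums\<close>

lemma sweedler_empty [simp]: "sweedler \<beta> {#} = \<beta> {#} {#}"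
proof -
  have *: "(1 :: hopf2) = Poly_Mapping.single ({#}, {#}) 1"
    by (simp add: zero_prod_def flip: single_one)
  show ?thesis
    by (simp add: sweedler_def coproduct_forest_def * del: single_one)
qed

lemma sweedler_Node:
  "sweedler \<beta> {#Node f#} = \<beta> {#} {#Node f#} + sweedler (\<lambda>a b. \<beta> {#Node a#} b) f"
  by (simp add: sweedler_def coproduct_forest_def lin_ext_add lin_ext_image[OF qlinear_lin_ext]
      case_prod_unfold)

lemma sweedler_plus:
  "sweedler \<beta> (f + g) = sweedler (\<lambda>a b. sweedler (\<lambda>c d. \<beta> (a + c) (b + d)) g) f"
  by (simp add: sweedler_def coproduct_forest_def lin_ext_mult case_prod_unfold)

lemma sweedler_add: "sweedler (\<lambda>a b. \<beta> a b + \<gamma> a b) f = sweedler \<beta> f + sweedler \<gamma> f"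
  by (simp add: sweedler_def lin_ext_fun_add case_prod_unfold)

lemma sweedler_image: "qlinear T \<Longrightarrow> T (sweedler \<beta> f) = sweedler (\<lambda>a b. T (\<beta> a b)) f"
  by (simp add: sweedler_def lin_ext_image case_prod_unfold)

lemma sweedler_diff: "sweedler (\<lambda>a b. \<beta> a b - \<gamma> a b) f = sweedler \<beta> f - sweedler \<gamma> f"
  using sweedler_add[of "\<lambda>a b. \<beta> a b - \<gamma> a b" \<gamma> f] by simp

lemma sweedler_mult_left: "(p :: 'a::monoid_add \<Rightarrow>\<^sub>0 rat) * sweedler \<beta> f = sweedler (\<lambda>a b. p * \<beta> a b) f"
  and sweedler_mult_right: "sweedler \<beta> f * (p :: 'a::monoid_add \<Rightarrow>\<^sub>0 rat) = sweedler (\<lambda>a b. \<beta> a b * p) f"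
  by (rule sweedler_image qlinear_mult_left qlinear_mult_right)+

lemma sweedler_diamond_left: "p \<diamondop> sweedler \<beta> f = sweedler (\<lambda>a b. p \<diamondop> \<beta> a b) f"
  and sweedler_diamond_right: "sweedler \<beta> f \<diamondop> p = sweedler (\<lambda>a b. \<beta> a b \<diamondop> p) f"
  by (rule sweedler_image qlinear_diamond_left qlinear_diamond_right)+

lemma sweedler_swap:
  "sweedler (\<lambda>a b. sweedler (\<lambda>c d. \<beta> a b c d) g) f = sweedler (\<lambda>c d. sweedler (\<lambda>a b. \<beta> a b c d) f) g"
  unfolding sweedler_def case_prod_unfold by (rule lin_ext_swap)

lemma sweedler_0 [simp]: "sweedler (\<lambda>a b. 0) f = 0"
  by (simp add: sweedler_def lin_ext_fun_0 case_prod_unfold)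

lemma sweedler_cong_all: "(\<And>a b. \<beta> a b = \<gamma> a b) \<Longrightarrow> sweedler \<beta> f = sweedler \<gamma> f"
  by presburger

text \<open>The coproduct is graded, so only pairs whose degrees add up to that of \<open>f\<close>
  occur.\<close>

lemma sweedler_cong:
  assumes "\<And>a b. degree_forest a + degree_forest b = degree_forest f \<Longrightarrow> \<beta> a b = \<gamma> a b"
  shows "sweedler \<beta> f = sweedler \<gamma> f"
  using assms
proof (induction f arbitrary: \<beta> \<gamma> rule: forest_induct)
  case (Node f)
  show ?case
    unfolding sweedler_Node
    by (intro arg_cong2[where f = "(+)"] Node.IH Node.prems) auto
next
  case (plus f g)
  show ?case
    unfolding sweedler_plus
    by (intro plus.IH plus.prems) auto
qed simp

text \<open>The counit axiom, with the counit of \<open>a\<close> written as a condition under the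
  sum.\<close>

lemma sweedler_left_counit: "sweedler (\<lambda>a b. if a = {#} then \<beta> b else 0) f = \<beta> f"
proof (induction f arbitrary: \<beta> rule: forest_induct)
  case (plus f g)
  have "(\<lambda>a b. sweedler (\<lambda>c d. if a + c = {#} then \<beta> (b + d) else 0) g)
      = (\<lambda>a b. if a = {#} then sweedler (\<lambda>c d. if c = {#} then \<beta> (b + d) else 0) g else 0)"
    by (auto simp: fun_eq_iff)
  then show ?case
    by (simp add: sweedler_plus plus)
qed (simp_all add: sweedler_Node)

lemma sweedler_right_counit: "sweedler (\<lambda>a b. if b = {#} then \<beta> a else 0) f = \<beta> f"
proof (induction f arbitrary: \<beta> rule: forest_induct)
  case (plus f g)
  have "(\<lambda>a b. sweedler (\<lambda>c d. if b + d = {#} then \<beta> (a + c) else 0) g)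
      = (\<lambda>a b. if b = {#} then sweedler (\<lambda>c d. if d = {#} then \<beta> (a + c) else 0) g else 0)"
    by (auto simp: fun_eq_iff)
  then show ?case
    by (simp add: sweedler_plus plus)
qed (simp_all add: sweedler_Node)

lemma sweedler_left_split:
  "sweedler \<beta> f = \<beta> {#} f + sweedler (\<lambda>a b. if a = {#} then 0 else \<beta> a b) f"
proof -
  have "sweedler \<beta> f = sweedler (\<lambda>a b. (if a = {#} then \<beta> {#} b else 0) + (if a = {#} then 0 else \<beta> a b)) f"
    by (rule sweedler_cong_all) simp
  then show ?thesis
    by (simp add: sweedler_add sweedler_left_counit)
qed

lemma sweedler_right_split:
  "sweedler \<beta> f = \<beta> f {#} + sweedler (\<lambda>a b. if b = {#} then 0 else \<beta> a b) f"
proof -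
  have "sweedler \<beta> f = sweedler (\<lambda>a b. (if b = {#} then \<beta> a {#} else 0) + (if b = {#} then 0 else \<beta> a b)) f"
    by (rule sweedler_cong_all) simp
  then show ?thesis
    by (simp add: sweedler_add sweedler_right_counit)
qed

text \<open>For a tree this follows from the cocycle form of the coproduct on B_+; for a product,
  from both factors after interchanging independent sums.\<close>

lemma sweedler_coassoc:
  "sweedler (\<lambda>a b. sweedler (\<lambda>c d. \<beta> c d b) a) f = sweedler (\<lambda>a b. sweedler (\<lambda>c d. \<beta> a c d) b) f"
proof (induction f arbitrary: \<beta> rule: forest_induct)
  case (Node f)
  then show ?case
    by (simp add: sweedler_Node sweedler_add add.assoc)
next
  case (plus f g)
  have "sweedler (\<lambda>a b. sweedler (\<lambda>c d. \<beta> c d b) a) (f + g)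
      = sweedler (\<lambda>a b. sweedler (\<lambda>c d. sweedler (\<lambda>a' b'. sweedler (\<lambda>c' d'.
          \<beta> (c + c') (d + d') (b + b')) a') g) a) f"
    unfolding sweedler_plus by (subst sweedler_swap) (rule refl)
  also have "\<dots> = sweedler (\<lambda>a b. sweedler (\<lambda>c d. sweedler (\<lambda>a' b'. sweedler (\<lambda>c' d'.
          \<beta> (a + a') (c + c') (d + d')) b') g) b) f"
    unfolding plus.IH(1) plus.IH(2) ..
  also have "\<dots> = sweedler (\<lambda>a b. sweedler (\<lambda>c d. \<beta> a c d) b) (f + g)"
    unfolding sweedler_plus by (subst sweedler_swap) (rule refl)
  finally show ?case .
qed simp

text \<open>All terms but one involve the values of \<open>A\<close> and \<open>B\<close> at forests of smaller degree only.\<close>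

lemma sweedler_cancel_left:
  assumes "\<And>f. sweedler (\<lambda>a b. m a (A b)) f = sweedler (\<lambda>a b. m a (B b)) f"
    and m: "\<And>p. m {#} p = (p :: 'l \<Rightarrow>\<^sub>0 rat)"
  shows "A f = B f"
proof (induction f rule: measure_induct_rule[of degree_forest])
  case (less f)
  have "sweedler (\<lambda>a b. if a = {#} then 0 else m a (A b)) f
      = sweedler (\<lambda>a b. if a = {#} then 0 else m a (B b)) f"
  proof (rule sweedler_cong)
    fix a b assume "degree_forest a + degree_forest b = degree_forest f"
    moreover have "a \<noteq> {#} \<Longrightarrow> 0 < degree_forest a"
      using degree_forest_eq_0[of a] by (simp del: degree_forest_eq_0)
    ultimately show "(if a = {#} then 0 else m a (A b)) = (if a = {#} then 0 else m a (B b))"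
      using less[of b] by auto
  qed
  with assms(1)[of f] show ?case
    by (simp add: sweedler_left_split[of "\<lambda>a b. m a (A b)"] sweedler_left_split[of "\<lambda>a b. m a (B b)"] m)
qed

lemma sweedler_cancel_right:
  assumes "\<And>f. sweedler (\<lambda>a b. m (A a) b) f = sweedler (\<lambda>a b. m (B a) b) f"
    and m: "\<And>p. m p {#} = (p :: 'l \<Rightarrow>\<^sub>0 rat)"
  shows "A f = B f"
proof (induction f rule: measure_induct_rule[of degree_forest])
  case (less f)
  have "sweedler (\<lambda>a b. if b = {#} then 0 else m (A a) b) f
      = sweedler (\<lambda>a b. if b = {#} then 0 else m (B a) b) f"
  proof (rule sweedler_cong)
    fix a b assume "degree_forest a + degree_forest b = degree_forest f"
    moreover have "b \<noteq> {#} \<Longrightarrow> 0 < degree_forest b"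
      using degree_forest_eq_0[of b] by (simp del: degree_forest_eq_0)
    ultimately show "(if b = {#} then 0 else m (A a) b) = (if b = {#} then 0 else m (B a) b)"
      using less[of a] by auto
  qed
  with assms(1)[of f] show ?case
    by (simp add: sweedler_right_split[of "\<lambda>a b. m (A a) b"] sweedler_right_split[of "\<lambda>a b. m (B a) b"] m)
qed

section \<open>The convolution inverse of the polynomials attached to forests\<close>

lemma G_forest_simps [simp]:
  "G_forest {#} = 1"
  "G_forest {#Node f#} = (if f = {#} then - yA else G_forest f * (2 * xA + yA))"
  "G_forest (f + g) = G_forest f \<diamondop> G_forest g"
  by (simp_all add: G_forest_def fold_diamond_add)

text \<open>The rooted tree map of \<open>f\<close> will send x to \<open>H_forest f * xA\<close>.
  By \<open>H_forest_factor\<close>, the inverse of left multiplication by y is applied only to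
  multiples of y.\<close>

primrec H_tree :: "tree \<Rightarrow> ncpoly" where
  "H_tree (Node f) = (if f = {#} then yA
     else yA * ((xA + 2 * yA) * inv ((*) yA) (fold_mset (\<diamondop>) 1 (image_mset H_tree f))))"

definition H_forest :: "forest \<Rightarrow> ncpoly" where
  "H_forest f = fold_mset (\<diamondop>) 1 (image_mset H_tree f)"

lemma H_forest_simps [simp]:
  "H_forest {#} = 1"
  "H_forest {#Node f#} = (if f = {#} then yA else yA * ((xA + 2 * yA) * inv ((*) yA) (H_forest f)))"
  "H_forest (f + g) = H_forest f \<diamondop> H_forest g"
  by (simp_all add: H_forest_def fold_diamond_add)

text \<open>This is -1 to the number of leaves.\<close>

primrec leaf_sign_tree :: "tree \<Rightarrow> rat" where
  "leaf_sign_tree (Node f) = (if f = {#} then - 1 else prod_mset (image_mset leaf_sign_tree f))"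

definition leaf_sign :: "forest \<Rightarrow> rat" where
  "leaf_sign f = prod_mset (image_mset leaf_sign_tree f)"

lemma leaf_sign_simps [simp]:
  "leaf_sign {#} = 1"
  "leaf_sign {#Node f#} = (if f = {#} then - 1 else leaf_sign f)"
  "leaf_sign (f + g) = leaf_sign f * leaf_sign g"
  by (simp_all add: leaf_sign_def)

lemma zA_power_diamond: "zA ^ n * p \<diamondop> q = zA ^ n * (p \<diamondop> q)"
  and diamond_zA_power: "p \<diamondop> (zA ^ n * q) = zA ^ n * (p \<diamondop> q)"
  by (induction n) (simp_all only: power_Suc power_0 mult_1_left mult.assoc zA_diamond diamond_zA)

definition chi :: "forest \<Rightarrow> ncpoly" where
  "chi f = qscale (leaf_sign f) (zA ^ degree_forest f)"

lemma chi_empty [simp]: "chi {#} = 1"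
  by (simp add: chi_def)

lemma chi_Node: "chi {#Node f#} = (if f = {#} then - zA else zA * chi f)"
  by (simp add: chi_def qscale_left_minus qscale_mult_right)

text \<open>Powers of z are scalars for the diamond product, and sign and power are multiplicative
  in the forest; this splits Sweedler sums over a union.\<close>

lemma chi_plus_diamond: "chi (f + g) * (p \<diamondop> q) = chi f * p \<diamondop> (chi g * q)"
  by (simp add: chi_def qscale_mult_left diamond_linear zA_power_diamond diamond_zA_power
      qscale_mult_right power_add mult.assoc
      mult.commute[of "leaf_sign f"] add.commute[of "degree_forest f"])

text \<open>
  Atkinson's factorization: left multiplication by \<open>x\<close> is a Rota--Baxter operator of weight
  \<open>-z\<close> for \<open>\<diamondop>\<close>, left multiplication by \<open>y = z - x\<close> is its complement, and the character
  \<open>chi\<close> with values in the polynomials in \<open>z\<close> has the convolution product \<open>chi * H\<close> in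
  the image of the one, and \<open>H\<close> in the image of the other.
\<close>

lemma H_forest_factor:
  assumes "f \<noteq> {#}"
  shows "\<exists>u. H_forest f = yA * u \<and> sweedler (\<lambda>a b. chi a * H_forest b) f = - (xA * u)"
  using assms
proof (induction f rule: forest_induct)
  case (Node f)
  show ?case
  proof (cases "f = {#}")
    case True
    \<comment> \<open>For a single vertex the sum is -z + y = -x, so u = 1.\<close>
    then show ?thesis
      by (intro exI[of _ 1]) (simp add: sweedler_Node chi_Node)
  next
    case False
    then obtain u where u: "H_forest f = yA * u"
      "sweedler (\<lambda>a b. chi a * H_forest b) f = - (xA * u)"
      using Node by blast
    \<comment> \<open>At the empty \<open>a\<close>, grafting gives -z instead of
      \<open>zA * chi a\<close> = z, hence the correction by 2z.\<close>
    have "sweedler (\<lambda>a b. chi {#Node a#} * H_forest b) f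
        = sweedler (\<lambda>a b. zA * (chi a * H_forest b) - (if a = {#} then 2 * zA * H_forest b else 0)) f"
      by (rule sweedler_cong_all) (simp add: chi_Node algebra_simps mult_2)
    also have "\<dots> = - (zA * (xA * u)) - 2 * zA * (yA * u)"
      by (simp only: sweedler_diff sweedler_left_counit u sweedler_mult_left[symmetric] mult_minus_right)
    finally have eq: "sweedler (\<lambda>a b. chi {#Node a#} * H_forest b) f
        = - (zA * (xA * u)) - 2 * zA * (yA * u)" .
    \<comment> \<open>The witness fits since y(x + 2y)u - zxu - 2zyu = -x(x + 2y)u.\<close>
    show ?thesis
      using False by (intro exI[of _ "(xA + 2 * yA) * u"]) (simp add: sweedler_Node u(1) eq algebra_simps mult_2)
  qed
next
  case (plus f g)
  show ?case
  proof (cases "f = {#} \<or> g = {#}")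
    case False
    then obtain u v where u: "H_forest f = yA * u" "sweedler (\<lambda>a b. chi a * H_forest b) f = - (xA * u)"
      and v: "H_forest g = yA * v" "sweedler (\<lambda>a b. chi a * H_forest b) g = - (xA * v)"
      using plus by blast
    have "sweedler (\<lambda>a b. chi a * H_forest b) (f + g)
        = sweedler (\<lambda>a b. chi a * H_forest b) f \<diamondop> sweedler (\<lambda>a b. chi a * H_forest b) g"
      unfolding sweedler_diamond_left sweedler_diamond_right
      by (simp add: sweedler_plus chi_plus_diamond) (rule sweedler_swap)
    also have "\<dots> = xA * u \<diamondop> (xA * v)"
      unfolding u v by (simp add: diamond_linear)
    also have "\<dots> = xA * (u \<diamondop> (xA * v) - yA * u \<diamondop> v)"
      by (simp add: diamond_xx right_diff_distrib)
    \<comment> \<open>Moving z from one factor to the other turns the bracket of the rule for x, x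
      into minus that of the rule for y, y.\<close>
    also have "u \<diamondop> (xA * v) - yA * u \<diamondop> v = - (u \<diamondop> (yA * v) - xA * u \<diamondop> v)"
      using zA_diamond[of u v] diamond_zA[of u v]
      by (simp add: distrib_right diamond_linear algebra_simps)
    finally show ?thesis
      by (intro exI[of _ "u \<diamondop> (yA * v) - xA * u \<diamondop> v"]) (simp add: u v diamond_yy right_diff_distrib)
  next
    case True
    with plus show ?thesis
      by auto
  qed
qed simp

text \<open>The quotient of \<open>chi\<close> by z on nonempty forests, where the degree is
  positive and the subtraction exact; the value 0 removes the empty left part from Sweedler
  sums.\<close>

definition kappa :: "forest \<Rightarrow> ncpoly" where
  "kappa f = (if f = {#} then 0 else qscale (leaf_sign f) (zA ^ (degree_forest f - 1)))"

lemma zA_kappa: "zA * kappa f = (if f = {#} then 0 else chi f)"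
proof (cases "f = {#}")
  case False
  then have "zA ^ degree_forest f = zA * zA ^ (degree_forest f - 1)"
    by (cases "degree_forest f") auto
  with False show ?thesis
    by (simp add: kappa_def chi_def qscale_mult_right)
qed (simp add: kappa_def)

lemma kappa_diamond: "kappa f * p \<diamondop> q = kappa f * (p \<diamondop> q)"
  by (simp add: kappa_def qscale_mult_left diamond_linear zA_power_diamond qlinear_0[OF qlinear_diamond_left])

text \<open>Multiplied by z, the sum becomes that for \<open>chi\<close> minus its term at the empty
  left part: -xu - yu = -zu. Then z cancels.\<close>

lemma sweedler_kappa_H:
  assumes "f \<noteq> {#}" "H_forest f = yA * u"
  shows "sweedler (\<lambda>a b. kappa a * H_forest b) f = - u"
proof (rule zA_cancel)
  have eta: "sweedler (\<lambda>a b. chi a * H_forest b) f = - (xA * u)"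
    using H_forest_factor[OF assms(1)] assms(2) yA_cancel by metis
  have "zA * sweedler (\<lambda>a b. kappa a * H_forest b) f
      = sweedler (\<lambda>a b. chi a * H_forest b - (if a = {#} then H_forest b else 0)) f"
    unfolding sweedler_mult_left mult.assoc[symmetric] zA_kappa
    by (rule sweedler_cong_all) simp
  also have "\<dots> = zA * - u"
    by (simp only: sweedler_diff sweedler_left_counit eta assms(2)) (simp add: algebra_simps)
  finally show "zA * sweedler (\<lambda>a b. kappa a * H_forest b) f = zA * - u" .
qed

text \<open>\<open>K_forest\<close> is the inverse of \<open>H_forest\<close> for the convolution given by concatenation.\<close>

definition K_forest :: "forest \<Rightarrow> ncpoly" where
  "K_forest f = (if f = {#} then 1 else yA * kappa f)"

lemma K_forest_empty [simp]: "K_forest {#} = 1"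
  by (simp add: K_forest_def)

text \<open>Values of \<open>kappa\<close> are scalars for the diamond product, so the sum collapses
  to \<open>sweedler_kappa_H\<close>. The cases p = 1 and p in xA give the next two facts.\<close>

lemma sweedler_K_H_diamond:
  assumes "f \<noteq> {#}" "H_forest f = yA * u"
  shows "sweedler (\<lambda>a b. K_forest a * (H_forest b \<diamondop> p)) f = yA * u \<diamondop> p - yA * (u \<diamondop> p)"
proof -
  have "sweedler (\<lambda>a b. K_forest a * (H_forest b \<diamondop> p)) f
      = sweedler (\<lambda>a b. (if a = {#} then H_forest b \<diamondop> p else 0)
          + yA * (kappa a * H_forest b \<diamondop> p)) f"
    by (rule sweedler_cong_all) (simp add: K_forest_def kappa_diamond mult.assoc kappa_def[of "{#}"])
  also have "\<dots> = H_forest f \<diamondop> p + yA * (sweedler (\<lambda>a b. kappa a * H_forest b) f \<diamondop> p)"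
    by (simp only: sweedler_add sweedler_left_counit sweedler_mult_left sweedler_diamond_right)
  finally show ?thesis
    by (simp add: sweedler_kappa_H[OF assms] assms(2) diamond_linear)
qed

lemma sweedler_K_H: "sweedler (\<lambda>a b. K_forest a * H_forest b) f = (if f = {#} then 1 else 0)"
proof (cases "f = {#}")
  case False
  then obtain u where "H_forest f = yA * u"
    using H_forest_factor by blast
  with False show ?thesis
    using sweedler_K_H_diamond[of f u 1] by simp
qed simp

lemma sweedler_K_H_xA:
  "sweedler (\<lambda>a b. K_forest a * (H_forest b \<diamondop> (xA * p))) f = xA * (H_forest f \<diamondop> p)"
proof (cases "f = {#}")
  case False
  then obtain u where "H_forest f = yA * u"
    using H_forest_factor by blast
  with False show ?thesis
    by (simp add: sweedler_K_H_diamond diamond_yx)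
qed simp

text \<open>Convolution inversion: K * (H * B) = (K * H) * B = B = K * A, and K cancels on the
  left.\<close>

lemma sweedler_H_of_K:
  assumes "\<And>f. sweedler (\<lambda>a b. K_forest a * A b) f = B f"
  shows "sweedler (\<lambda>a b. H_forest a * B b) f = A f"
proof (rule sweedler_cancel_left[where m = "\<lambda>a p. K_forest a * p"])
  fix f
  have "sweedler (\<lambda>a b. K_forest a * sweedler (\<lambda>a b. H_forest a * B b) b) f
      = sweedler (\<lambda>a b. sweedler (\<lambda>c d. K_forest c * H_forest d) a * B b) f"
    by (simp only: sweedler_mult_left sweedler_mult_right mult.assoc
        sweedler_coassoc[where \<beta> = "\<lambda>a b c. K_forest a * (H_forest b * B c)"])
  also have "\<dots> = sweedler (\<lambda>a b. if a = {#} then B b else 0) f"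
    by (rule sweedler_cong_all) (simp add: sweedler_K_H)
  finally show "sweedler (\<lambda>a b. K_forest a * sweedler (\<lambda>a b. H_forest a * B b) b) f
      = sweedler (\<lambda>a b. K_forest a * A b) f"
    by (simp add: sweedler_left_counit assms)
qed simp

text \<open>This will become the Leibniz rule of the rooted tree maps for the first letter
  x.\<close>

lemma H_diamond_xA:
  "H_forest f \<diamondop> (xA * p) = sweedler (\<lambda>a b. H_forest a * (xA * (H_forest b \<diamondop> p))) f"
  by (rule sweedler_H_of_K[symmetric]) (rule sweedler_K_H_xA)

text \<open>An expansion for the right factor extends to all its left multiples, by coassociativity.
  It is applied to r = 2x + y, the factor in the recursion for \<open>G_forest\<close>.\<close>

lemma H_diamond_mult:
  assumes "\<And>f. H_forest f \<diamondop> r = sweedler (\<lambda>a b. H_forest a * R b) f"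
  shows "H_forest f \<diamondop> (p * r) = sweedler (\<lambda>a b. (H_forest a \<diamondop> p) * R b) f"
proof (induction p arbitrary: f rule: ncpoly_induct_left)
  case 1
  then show ?case
    by (simp add: assms)
next
  case (x p)
  have "H_forest f \<diamondop> (xA * p * r) = sweedler (\<lambda>a b. H_forest a * (xA * (H_forest b \<diamondop> (p * r)))) f"
    by (simp only: mult.assoc H_diamond_xA)
  also have "\<dots> = sweedler (\<lambda>a b. sweedler (\<lambda>c d. H_forest c * (xA * (H_forest d \<diamondop> p))) a * R b) f"
    by (simp only: x.IH sweedler_mult_left sweedler_mult_right mult.assoc
       sweedler_coassoc[where \<beta> = "\<lambda>a b c. H_forest a * (xA * ((H_forest b \<diamondop> p) * R c))"])
  finally show ?case
    by (simp only: H_diamond_xA)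
next
  case (scale c p)
  then show ?case
    by (simp only: qscale_mult_left diamond_linear sweedler_image[of "qscale c"] qlinear_iff
        qscale_add qscale_qscale mult.commute simp_thms)
next
  case (z p)
  then show ?case
    by (simp only: diamond_zA mult.assoc sweedler_mult_left)
qed (simp_all only: distrib_right diamond_linear sweedler_add)

lemma sweedler_G_H: "sweedler (\<lambda>a b. G_forest a \<diamondop> H_forest b) f = (if f = {#} then 1 else 0)"
proof (induction f rule: measure_induct_rule[of degree_forest])
  case (less f)
  show ?case
  proof (cases f rule: forest_cases)
    case (Node g)
    show ?thesis
    proof (cases "g = {#}")
      case True
      with Node show ?thesis
        by (simp add: sweedler_Node)
    next
      case False
      then obtain u where u: "H_forest g = yA * u"
        using H_forest_factor by blast
      \<comment> \<open>By inversion of K, this choice makes the convolution of H with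
        \<open>R\<close> equal to H \<diamondop> (2x + y).\<close>
      define R where "R f = sweedler (\<lambda>a b. K_forest a * (H_forest b \<diamondop> (2 * xA + yA))) f" for f
      have R: "H_forest f \<diamondop> (2 * xA + yA) = sweedler (\<lambda>a b. H_forest a * R b) f" for f
        by (rule sweedler_H_of_K[symmetric]) (simp add: R_def)
      \<comment> \<open>Here 2x + y is split as x + z.\<close>
      have *: "p \<diamondop> (2 * xA + yA) = p \<diamondop> xA + zA * p" for p
        using diamond_zA[of p 1] by (simp add: diamond_linear mult_2 add.assoc)
      have "yA * u \<diamondop> xA = yA * (u \<diamondop> xA) + xA * (yA * u)"
        using diamond_yx[of u 1] by simp
      then have R_g: "R g = zA * yA * u + xA * (yA * u) - yA * (zA * u)"
        unfolding R_def sweedler_K_H_diamond[OF False u] unfolding * by (simp add: algebra_simps)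
      have "sweedler (\<lambda>a b. G_forest a * (2 * xA + yA) \<diamondop> H_forest b) g
          = sweedler (\<lambda>a b. sweedler (\<lambda>c d. (G_forest a \<diamondop> H_forest c) * R d) b) g"
        by (simp only: diamond_commute[of _ "H_forest _"] H_diamond_mult[OF R])
      also have "\<dots> = sweedler (\<lambda>a b. sweedler (\<lambda>c d. G_forest c \<diamondop> H_forest d) a * R b) g"
        by (simp only: sweedler_mult_right
            sweedler_coassoc[where \<beta> = "\<lambda>a c d. (G_forest a \<diamondop> H_forest c) * R d"])
      \<comment> \<open>The left parts have degree at most that of \<open>g\<close>, which is below
        that of \<open>f\<close>.\<close>
      also have "\<dots> = sweedler (\<lambda>a b. if a = {#} then R b else 0) g"
        using Node(2) by (intro sweedler_cong) (simp add: less)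
      finally have G_R: "sweedler (\<lambda>a b. G_forest a * (2 * xA + yA) \<diamondop> H_forest b) g = R g"
        by (simp only: sweedler_left_counit)
      \<comment> \<open>At the empty \<open>a\<close> the value is -y = (2x + y) - 2z, hence the
        correction term.\<close>
      have "sweedler (\<lambda>a b. G_forest {#Node a#} \<diamondop> H_forest b) g
          = sweedler (\<lambda>a b. G_forest a * (2 * xA + yA) \<diamondop> H_forest b
              - (if a = {#} then 2 * (zA * H_forest b) else 0)) g"
      proof (rule sweedler_cong_all)
        fix a b
        have "2 * xA \<diamondop> p = xA \<diamondop> p + xA \<diamondop> p" "xA \<diamondop> p + yA \<diamondop> p = xA * p + yA * p" for p
          using zA_diamond[of 1 p] by (simp_all add: mult_2 diamond_linear distrib_right)
        then show "G_forest {#Node a#} \<diamondop> H_forest b = G_forest a * (2 * xA + yA) \<diamondop> H_forest b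
              - (if a = {#} then 2 * (zA * H_forest b) else 0)"
          by (simp add: diamond_linear algebra_simps mult_2)
      qed
      also have "\<dots> = R g - 2 * (zA * H_forest g)"
        by (simp only: sweedler_diff sweedler_left_counit G_R)
      finally show ?thesis
        using False Node(1) by (simp add: sweedler_Node R_g u algebra_simps mult_2)
    qed
  next
    case (plus g h)
    have "G_forest (a + c) \<diamondop> H_forest (b + d)
        = (G_forest a \<diamondop> H_forest b) \<diamondop> (G_forest c \<diamondop> H_forest d)" for a b c d
      by (simp add: diamond_assoc diamond_commute[of "G_forest c"])
    then have "sweedler (\<lambda>a b. G_forest a \<diamondop> H_forest b) f
        = sweedler (\<lambda>a b. G_forest a \<diamondop> H_forest b) g \<diamondop> sweedler (\<lambda>a b. G_forest a \<diamondop> H_forest b) h"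
      unfolding plus(1) sweedler_diamond_left sweedler_diamond_right sweedler_plus
      by simp (rule sweedler_swap)
    then show ?thesis
      using plus by (auto simp: less qlinear_0[OF qlinear_diamond_left])
  qed simp
qed

section \<open>The antipode\<close>

text \<open>The recursion obtained by solving S * id = counit for the summand with empty right part.
  The guard on degrees excludes that summand and ensures termination.\<close>

function antipode_forest :: "forest \<Rightarrow> hopf" where
  "antipode_forest f = (if f = {#} then 1 else
     - sweedler (\<lambda>a b. if degree_forest a < degree_forest f
         then antipode_forest a * Poly_Mapping.single b 1 else 0) f)"
  by pat_completeness auto
termination
  by (relation "measure degree_forest") auto

declare antipode_forest.simps [simp del]

lemma antipode_forest_empty [simp]: "antipode_forest {#} = 1"
  by (subst antipode_forest.simps) simp

lemma antipode_forest_left: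
  "sweedler (\<lambda>a b. antipode_forest a * Poly_Mapping.single b 1) f = (if f = {#} then 1 else 0)"
proof (cases "f = {#}")
  case False
  have "sweedler (\<lambda>a b. if b = {#} then 0 else antipode_forest a * Poly_Mapping.single b 1) f
      = sweedler (\<lambda>a b. if degree_forest a < degree_forest f
          then antipode_forest a * Poly_Mapping.single b 1 else 0) f"
  proof (rule sweedler_cong)
    fix a b assume "degree_forest a + degree_forest b = degree_forest f"
    then have "b = {#} \<longleftrightarrow> \<not> degree_forest a < degree_forest f"
      unfolding degree_forest_eq_0[symmetric] by linarith
    then show "(if b = {#} then 0 else antipode_forest a * Poly_Mapping.single b 1)
        = (if degree_forest a < degree_forest f then antipode_forest a * Poly_Mapping.single b 1 else 0)"
      by simp
  qed
  also have "\<dots> = - antipode_forest f"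
    using False by (subst (2) antipode_forest.simps) simp
  finally show ?thesis
    using False by (simp add: sweedler_right_split[of "\<lambda>a b. antipode_forest a * Poly_Mapping.single b 1"])
qed simp

text \<open>Cancel \<open>S\<close> on the left in \<open>S * (id * S) = (S * id) * S = S = S * \<epsilon>\<close>.\<close>

lemma antipode_forest_right:
  "sweedler (\<lambda>a b. Poly_Mapping.single a 1 * antipode_forest b) f = (if f = {#} then 1 else 0)"
proof (rule sweedler_cancel_left[where m = "\<lambda>a p. antipode_forest a * p"
      and A = "sweedler (\<lambda>a b. Poly_Mapping.single a 1 * antipode_forest b)"
      and B = "\<lambda>f. if f = {#} then 1 else 0"])
  fix f
  have "sweedler (\<lambda>a b. antipode_forest a *
        sweedler (\<lambda>a b. Poly_Mapping.single a 1 * antipode_forest b) b) f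
      = sweedler (\<lambda>a b. sweedler (\<lambda>c d. antipode_forest c * Poly_Mapping.single d 1) a * antipode_forest b) f"
    by (simp only: sweedler_mult_left sweedler_mult_right mult.assoc
        sweedler_coassoc[where \<beta> = "\<lambda>a b c. antipode_forest a * (Poly_Mapping.single b 1 * antipode_forest c)"])
  also have "\<dots> = sweedler (\<lambda>a b. if a = {#} then antipode_forest b else 0) f"
    by (rule sweedler_cong_all) (simp add: antipode_forest_left)
  also have "\<dots> = sweedler (\<lambda>a b. if b = {#} then antipode_forest a else 0) f"
    by (simp only: sweedler_left_counit sweedler_right_counit)
  also have "\<dots> = sweedler (\<lambda>a b. antipode_forest a * (if b = {#} then 1 else 0)) f"
    by (rule sweedler_cong_all) simp
  finally show "sweedler (\<lambda>a b. antipode_forest a *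
        sweedler (\<lambda>a b. Poly_Mapping.single a 1 * antipode_forest b) b) f
      = sweedler (\<lambda>a b. antipode_forest a * (if b = {#} then 1 else 0)) f" .
qed simp

lemma counit_single: "counit (Poly_Mapping.single f 1) = (if f = {#} then 1 else 0)"
  by (simp add: counit_def lookup_single)

lemma qlinear_counit: "qlinear (\<lambda>h. qscale (counit h) p)"
  by (simp add: qlinear_iff counit_def lookup_add qscale_left_add)

lemma is_antipode_iff:
  "is_antipode S \<longleftrightarrow> qlinear S \<and>
     (\<forall>f. sweedler (\<lambda>a b. S (Poly_Mapping.single a 1) * Poly_Mapping.single b 1) f = (if f = {#} then 1 else 0)) \<and>
     (\<forall>f. sweedler (\<lambda>a b. Poly_Mapping.single a 1 * S (Poly_Mapping.single b 1)) f = (if f = {#} then 1 else 0))"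
proof -
  have "(\<forall>h. lin_ext (case_prod \<beta>) (coproduct h) = qscale (counit h) 1)
      \<longleftrightarrow> (\<forall>f. sweedler \<beta> f = (if f = {#} then 1 else 0))" for \<beta> :: "forest \<Rightarrow> forest \<Rightarrow> hopf"
  proof
    assume *: "\<forall>h. lin_ext (case_prod \<beta>) (coproduct h) = qscale (counit h) 1"
    show "\<forall>f. sweedler \<beta> f = (if f = {#} then 1 else 0)"
    proof
      fix f
      show "sweedler \<beta> f = (if f = {#} then 1 else 0)"
        using *[rule_format, of "Poly_Mapping.single f 1"]
        by (simp add: sweedler_def coproduct_def counit_single)
    qed
  next
    assume *: "\<forall>f. sweedler \<beta> f = (if f = {#} then 1 else 0)"
    have "lin_ext (case_prod \<beta>) (coproduct h) = qscale (counit h) 1" for h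
    proof (rule qlinear_eqI[of "\<lambda>h. lin_ext (case_prod \<beta>) (coproduct h)" "\<lambda>h. qscale (counit h) 1"])
      show "qlinear (\<lambda>h. lin_ext (case_prod \<beta>) (coproduct h))"
        unfolding coproduct_def by (rule qlinear_comp[OF qlinear_lin_ext qlinear_lin_ext])
      fix f
      show "lin_ext (case_prod \<beta>) (coproduct (Poly_Mapping.single f 1))
          = qscale (counit (Poly_Mapping.single f 1)) 1"
        using * by (simp add: sweedler_def coproduct_def counit_single)
    qed (rule qlinear_counit)
    then show "\<forall>h. lin_ext (case_prod \<beta>) (coproduct h) = qscale (counit h) 1" ..
  qed
  then show ?thesis
    unfolding is_antipode_def by (intro arg_cong2[where f = "(\<and>)"] refl)
qed

text \<open>Existence comes from the recursion. For uniqueness, the identity map cancels on the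
  right of S * id.\<close>

lemma is_antipode_antipode: "is_antipode antipode"
  unfolding antipode_def
proof (rule theI[of is_antipode])
  show "is_antipode (lin_ext antipode_forest)"
    by (simp add: is_antipode_iff qlinear_lin_ext antipode_forest_left antipode_forest_right)
next
  fix S
  assume S: "is_antipode S"
  show "S = lin_ext antipode_forest"
  proof
    fix h
    have "S (Poly_Mapping.single f 1) = antipode_forest f" for f
      by (rule sweedler_cancel_right[where m = "\<lambda>p b. p * Poly_Mapping.single b 1"])
        (use S in \<open>simp_all add: is_antipode_iff antipode_forest_left\<close>)
    note * = this
    show "S h = lin_ext antipode_forest h"
      by (rule qlinear_eqI[of S]) (use S in \<open>simp_all add: * is_antipode_iff qlinear_lin_ext\<close>)
  qed
qed

lemma lin_ext_H_mult: "lin_ext H_forest (p * q) = lin_ext H_forest p \<diamondop> lin_ext H_forest q"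
  by (simp add: lin_ext_mult lin_ext_image[OF qlinear_diamond_left] lin_ext_image[OF qlinear_diamond_right])
    (rule lin_ext_swap)

text \<open>As H is multiplicative, H composed with S is a left convolution inverse of H for the
  diamond product. So is G, and H cancels on the right.\<close>

lemma H_antipode: "lin_ext H_forest (antipode h) = G h"
proof -
  have S: "qlinear antipode"
    "sweedler (\<lambda>a b. antipode (Poly_Mapping.single a 1) * Poly_Mapping.single b 1) f = (if f = {#} then 1 else 0)" for f
    using is_antipode_antipode by (simp_all add: is_antipode_iff)
  have "lin_ext H_forest (antipode (Poly_Mapping.single f 1)) = G_forest f" for f
  proof (rule sweedler_cancel_right[where m = "\<lambda>p b. p \<diamondop> H_forest b"])
    fix f
    have "sweedler (\<lambda>a b. lin_ext H_forest (antipode (Poly_Mapping.single a 1)) \<diamondop> H_forest b) f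
        = lin_ext H_forest (sweedler (\<lambda>a b. antipode (Poly_Mapping.single a 1) * Poly_Mapping.single b 1) f)"
      by (simp add: sweedler_image[OF qlinear_lin_ext] lin_ext_H_mult)
    \<comment> \<open>The unit is written as the basis vector of the empty forest, which linear
      extension can evaluate.\<close>
    also have "\<dots> = lin_ext H_forest (if f = {#} then Poly_Mapping.single {#} 1 else 0)"
      by (simp add: S(2))
    also have "\<dots> = sweedler (\<lambda>a b. G_forest a \<diamondop> H_forest b) f"
      by (simp add: sweedler_G_H del: single_one)
    finally show "sweedler (\<lambda>a b. lin_ext H_forest (antipode (Poly_Mapping.single a 1)) \<diamondop> H_forest b) f
        = sweedler (\<lambda>a b. G_forest a \<diamondop> H_forest b) f" .
  qed simp
  note * = this
  show ?thesis
    unfolding G_def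
    by (rule qlinear_eqI[of "\<lambda>h. lin_ext H_forest (antipode h)"])
      (simp_all add: * qlinear_lin_ext qlinear_comp[OF qlinear_lin_ext S(1)])
qed

section \<open>The rooted tree maps\<close>

lemma is_rooted_tree_mapsD:
  assumes "is_rooted_tree_maps F"
  shows "qlinear (F f)" "F {#} = id"
    "F {#Node {#}#} xA = yA * xA" "F {#Node {#}#} yA = - (yA * xA)"
    "u \<in> {xA, yA} \<Longrightarrow> f \<noteq> {#} \<Longrightarrow> F {#Node f#} u = yA * ((xA + 2 * yA) * inv ((*) yA) (F f u))"
    "u \<in> {xA, yA} \<Longrightarrow> F (g + h) u = F g (F h u)"
    "u \<in> {xA, yA} \<Longrightarrow> F f (u * w) = sweedler (\<lambda>a b. F a u * F b w) f"
  using assms unfolding is_rooted_tree_maps_def sweedler_def by blast+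

lemma rooted_tree_maps_unique:
  assumes E: "is_rooted_tree_maps E" and F: "is_rooted_tree_maps F"
  shows "E = F"
proof -
  note E = is_rooted_tree_mapsD[OF E] and F = is_rooted_tree_mapsD[OF F]
  have "E f = F f" for f
  proof (induction f rule: measure_induct_rule[of degree_forest])
    case (less f)
    \<comment> \<open>Degree equal to that of \<open>f\<close> is included because \<open>f\<close>
      itself occurs as a left part.\<close>
    have letter: "E a u = F a u"
      if u: "u \<in> {xA, yA}" and a: "degree_forest a \<le> degree_forest f" for a u
    proof (cases a rule: forest_cases)
      case empty
      then show ?thesis
        by (simp only: E(2) F(2))
    next
      case (Node g)
      show ?thesis
      proof (cases "g = {#}")
        case True
        then show ?thesis
          using u by (auto simp only: Node(1) E(3,4) F(3,4))
      next
        case False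
        from Node(2) a have "E g = F g"
          by (intro less) simp
        then show ?thesis
          by (simp only: Node(1) E(5)[OF u False] F(5)[OF u False])
      qed
    next
      case (plus g h)
      with a have "E g = F g" "E h = F h"
        by (auto intro!: less)
      then show ?thesis
        unfolding plus(1) E(6)[OF u] F(6)[OF u] by simp
    qed
    have rest: "sweedler (\<lambda>a b. if a = {#} then 0 else E a u * E b w) f
        = sweedler (\<lambda>a b. if a = {#} then 0 else F a u * F b w) f" if u: "u \<in> {xA, yA}" for u w
    proof (rule sweedler_cong)
      fix a b assume "degree_forest a + degree_forest b = degree_forest f"
      moreover have "a \<noteq> {#} \<Longrightarrow> degree_forest a > 0"
        using degree_forest_eq_0[of a] by (simp del: degree_forest_eq_0)
      ultimately show "(if a = {#} then 0 else E a u * E b w) = (if a = {#} then 0 else F a u * F b w)"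
        using letter[OF u, of a] less[of b] by auto
    qed
    \<comment> \<open>All Leibniz terms but the one with empty left part agree. The equivalence is
      used in both directions.\<close>
    have mult: "E f (u * w) = F f (u * w) \<longleftrightarrow> u * E f w = u * F f w" if u: "u \<in> {xA, yA}" for u w
      unfolding E(7)[OF u] F(7)[OF u] sweedler_left_split[of "\<lambda>a b. E a u * E b w"]
        sweedler_left_split[of "\<lambda>a b. F a u * F b w"] rest[OF u] by (simp add: E(2) F(2))
    have "E f (word w) = F f (word w)" for w
    proof (induction w)
      case Nil
      \<comment> \<open>No clause prescribes the value at 1 directly; it is recovered from the value
        at x by cancelling x.\<close>
      have "E f (xA * 1) = F f (xA * 1)"
        by (simp add: letter)
      then show ?case
        unfolding word_Nil by (subst (asm) mult) (auto dest: xA_cancel)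
    next
      case (Cons a w)
      then show ?case
        by (cases a) (simp_all add: word_Cons mult)
    qed
    then have "E f p = F f p" for p
      by (rule ncpoly_eqI[OF E(1) F(1)])
    then show ?case ..
  qed
  then show ?thesis ..
qed

text \<open>The argument is the reversed word, and a last letter \<open>y\<close> is treated as \<open>z - x\<close>.\<close>

fun rtm_rev_word :: "forest \<Rightarrow> letter list \<Rightarrow> ncpoly" where
  "rtm_rev_word f [] = (if f = {#} then 1 else 0)"
| "rtm_rev_word f (X # w) = (H_forest f \<diamondop> word (rev w)) * xA"
| "rtm_rev_word f (Y # w) = rtm_rev_word f w * zA - (H_forest f \<diamondop> word (rev w)) * xA"

definition rtm :: "forest \<Rightarrow> ncpoly \<Rightarrow> ncpoly" where
  "rtm f = lin_ext (\<lambda>w. rtm_rev_word f (rev w))"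

section \<open>The explicit maps satisfy the defining clauses\<close>

lemma qlinear_rtm: "qlinear (rtm f)"
  unfolding rtm_def by (rule qlinear_lin_ext)

lemmas rtm_linear = qlinear_add[OF qlinear_rtm] qlinear_diff[OF qlinear_rtm] qlinear_scale[OF qlinear_rtm]

lemma rtm_word: "rtm f (word w) = rtm_rev_word f (rev w)"
  by (simp add: rtm_def word_def)

lemma rtm_1: "rtm f 1 = (if f = {#} then 1 else 0)"
  using rtm_word[of f "[]"] by (simp add: word_Nil)

lemma rtm_mult_xA: "rtm f (p * xA) = (H_forest f \<diamondop> p) * xA"
  by (rule ncpoly_eqI, (intro ncpoly_linears qlinear_id qlinear_rtm qlinear_comp[OF qlinear_rtm])+)
    (simp add: xA_def word_mult rtm_word)

lemma rtm_mult_zA: "rtm f (p * zA) = rtm f p * zA"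
proof (rule ncpoly_eqI[of "\<lambda>p. rtm f (p * zA)" "\<lambda>p. rtm f p * zA"])
  fix w
  have "rtm f (word w * yA) = rtm f (word w) * zA - rtm f (word w * xA)"
    by (simp add: rtm_mult_xA) (simp add: yA_def word_mult rtm_word)
  then show "rtm f (word w * zA) = rtm f (word w) * zA"
    by (simp add: distrib_left rtm_linear)
qed (intro ncpoly_linears qlinear_id qlinear_rtm qlinear_comp[OF qlinear_rtm])+

lemma rtm_empty: "rtm {#} = id"
proof
  fix p
  show "rtm {#} p = id p"
    by (induction p rule: ncpoly_induct_right)
      (simp_all add: rtm_1 rtm_mult_xA rtm_mult_zA rtm_linear del: distrib_left)
qed

text \<open>On multiples w x this is associativity of the diamond product; right multiplication by z
  passes through.\<close>

lemma rtm_plus: "rtm (f + g) p = rtm f (rtm g p)"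
proof (induction p rule: ncpoly_induct_right)
  case 1
  then show ?case
    by (auto simp: rtm_1 qlinear_0[OF qlinear_rtm])
qed (simp_all only: rtm_mult_xA rtm_mult_zA rtm_linear H_forest_simps diamond_assoc)

lemma rtm_xA: "rtm f xA = H_forest f * xA"
  using rtm_mult_xA[of f 1] by simp

lemma rtm_zA: "rtm f zA = (if f = {#} then zA else 0)"
  using rtm_mult_zA[of f 1] by (simp add: rtm_1 del: distrib_left)

lemma rtm_yA: "rtm f yA = (if f = {#} then zA else 0) - H_forest f * xA"
  using rtm_zA[of f] by (simp add: rtm_linear rtm_xA eq_diff_eq add.commute)

text \<open>Induction from the right: the substantial case, a last letter x, is
  \<open>H_diamond_xA\<close>.\<close>

lemma rtm_xA_mult: "rtm f (xA * p) = sweedler (\<lambda>a b. rtm a xA * rtm b p) f"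
proof (induction p rule: ncpoly_induct_right)
  case 1
  have "sweedler (\<lambda>a b. rtm a xA * rtm b 1) f = sweedler (\<lambda>a b. if b = {#} then rtm a xA else 0) f"
    by (rule sweedler_cong_all) (simp add: rtm_1)
  then show ?case
    by (simp add: sweedler_right_counit)
next
  case (x p)
  show ?case
    by (simp only: mult.assoc[symmetric, of xA p xA] rtm_mult_xA H_diamond_xA sweedler_mult_right rtm_xA)
      (simp only: mult.assoc)
next
  case (z p)
  then show ?case
    by (simp only: mult.assoc[symmetric] rtm_mult_zA sweedler_mult_right)
next
  case (scale c p)
  then show ?case
    by (simp only: qscale_mult_right rtm_linear sweedler_image[of "qscale c"] qlinear_iff
        qscale_add qscale_qscale mult.commute simp_thms)
qed (simp_all only: distrib_left rtm_linear sweedler_add)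

lemma rtm_zA_mult: "rtm f (zA * p) = zA * rtm f p"
proof (induction p rule: ncpoly_induct_right)
  case 1
  then show ?case
    by (simp add: rtm_1 rtm_zA)
next
  case (x p)
  then show ?case
    by (simp only: mult.assoc[symmetric, of zA p xA] rtm_mult_xA diamond_zA) (simp only: mult.assoc)
next
  case (z p)
  then show ?case
    by (simp only: mult.assoc[symmetric, of zA p zA] rtm_mult_zA) (simp only: mult.assoc)
qed (simp_all only: distrib_left[of zA] rtm_linear qscale_mult_right)

text \<open>Write y = z - x. The maps of nonempty forests kill z, so the Leibniz sum for z has one
  term, and \<open>rtm_zA_mult\<close> evaluates it.\<close>

lemma rtm_yA_mult: "rtm f (yA * p) = sweedler (\<lambda>a b. rtm a yA * rtm b p) f"
proof -
  have "sweedler (\<lambda>a b. rtm a yA * rtm b p) f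
      = sweedler (\<lambda>a b. (if a = {#} then zA * rtm b p else 0) - rtm a xA * rtm b p) f"
    by (rule sweedler_cong_all) (simp add: rtm_yA rtm_xA left_diff_distrib)
  also have "\<dots> = rtm f (zA * p) - rtm f (xA * p)"
    by (simp only: sweedler_diff sweedler_left_counit rtm_zA_mult rtm_xA_mult)
  finally show ?thesis
    by (simp add: distrib_right rtm_linear)
qed

lemma is_rooted_tree_maps_rtm: "is_rooted_tree_maps rtm"
proof -
  have letter: "(\<exists>v. rtm f u = yA * v) \<and>
      rtm {#Node f#} u = yA * ((xA + 2 * yA) * inv ((*) yA) (rtm f u))"
    if u: "u \<in> {xA, yA}" and f: "f \<noteq> {#}" for f u
  proof -
    obtain v where v: "H_forest f = yA * v"
      using H_forest_factor[OF f] by blast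
    \<comment> \<open>The quotient of \<open>rtm f u\<close> by y: x goes to
      \<open>H_forest f * xA\<close> and y to its negative.\<close>
    define s where "s = (if u = xA then v * xA else - (v * xA))"
    have "rtm f u = yA * s" "rtm {#Node f#} u = yA * ((xA + 2 * yA) * s)"
      using u f by (auto simp: s_def rtm_xA rtm_yA v mult.assoc)
    then show ?thesis
      by auto
  qed
  show ?thesis
    unfolding is_rooted_tree_maps_def sweedler_def[symmetric]
    using letter by (auto simp: qlinear_rtm rtm_empty rtm_plus rtm_xA rtm_yA rtm_xA_mult rtm_yA_mult)
qed

lemma rooted_tree_map_forest_eq_rtm: "rooted_tree_map_forest = rtm"
  unfolding rooted_tree_map_forest_def
  by (rule the_equality) (auto intro: is_rooted_tree_maps_rtm rooted_tree_maps_unique)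

theorem theorem1p2:
  fixes f :: hopf and w :: ncpoly
  shows "rooted_tree_map (antipode f) (w * xA) = (G f \<diamondop> w) * xA"
proof -
  \<comment> \<open>On forests the map is given by H, so linearity moves the extension onto H, whose
    value at the antipode is G.\<close>
  have "qlinear (\<lambda>p. (p \<diamondop> w) * xA)"
    by (intro qlinear_comp[OF qlinear_mult_left] qlinear_diamond_left)
  from lin_ext_image[OF this, of H_forest "antipode f"] show ?thesis
    by (simp add: rooted_tree_map_def rooted_tree_map_forest_eq_rtm rtm_mult_xA H_antipode)
qed

end
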